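(* Let $(\alpha_n)_{n\ge1}$ be an arbitrary sequence of positive integers, $u_1\in\mathbb Z_{>1}$ and $m\in\mathbb Z_{>0}$. Suppose the sequence $(u_n)_{n\ge1}$ satisfies either (A) $u_{n+2}u_n=\alpha_nu_{n+1}^3(u_{n+1}+1)$ for $n\ge1$, with $u_2=mu_1^2(u_1+1)$; or (B) $u_{n+2}=\alpha_nu_{n+1}^2(u_n+1)$ for $n\ge1$, with $u_2=mu_1$. Let $\varepsilon_j\in\{\pm1\}$ ($j\ge2$) be arbitrary signs and $$S'=\frac1{u_1}+\sum_{j=2}^\infty\frac{\varepsilon_j}{u_1(u_1+1)\cdots u_{j-1}(u_{j-1}+1)u_j}.$$ Set $\rho_n=m\prod_{k=1}^{n-1}\alpha_k$ for $n\ge1$, and for $n\ge1$ let $z_{n+1}=u_n(u_n+1)^2\rho_n$ in case (A), and $z_{n+1}=(u_n+1)\rho_n$ in case (B). Define $\Phi_1=[0;u_1]$, $\Phi_2=\varphi_{z_2}^{(-\varepsilon_2)}(\Phi_1)$ and $\Phi_{n+1}=\varphi_{z_{n+1}}^{(\varepsilon_{n+1})}(\Phi_n)$ for $n\ge2$. Then for each $n\ge1$ the $n$th partial sum of $S'$ equals $\Phi_n$, and the continued fraction expansion of $S'$ is the limit of the $\Phi_n$: $$S'=\cdots\varphi_{z_4}^{(\varepsilon_4)}\varphi_{z_3}^{(\varepsilon_3)}\varphi_{z_2}^{(-\varepsilon_2)}([0;u_1]).$$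
   Context: A finite regular continued fraction is $[a_0;a_1,\ldots,a_n]=a_0+1/(a_1+1/(\cdots+1/a_n))$ with $a_0\in\mathbb Z$, $a_i\in\mathbb Z_{>0}$. For $\mathbf a=(a_1,\ldots,a_n)$, $n\ge1$, let $\mathbf a^R=(a_n,\ldots,a_1)$, $\tilde{\mathbf a}=(a_1,\ldots,a_{n-1},a_n-1,1)$, and $\tilde{\mathbf a}^R$ its reversal. For a positive integer $z$: $\varphi_z^{(+1)}([a_0;\mathbf a])=[a_0;\mathbf a,z-1,\tilde{\mathbf a}^R]$ and $\varphi_z^{(-1)}([a_0;\mathbf a])=[a_0;\tilde{\mathbf a},z-1,\mathbf a^R]$. Whenever a zero partial quotient appears it is removed by the concatenation rule $[\ldots,A,0,B,\ldots]=[\ldots,A+B,\ldots]$. *)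

theory Defs
  imports Complex_Main
begin

text \<open>
  A finite continued fraction \<open>[a\<^sub>0; a\<^sub>1, \<dots>, a\<^sub>n]\<close> is the list of its partial quotients, including
  \<open>a\<^sub>0\<close>. Lists rather than values are needed because \<open>\<phi>\<close> depends on the chosen expansion
  (\<open>[\<dots>, a\<^sub>n]\<close> and \<open>[\<dots>, a\<^sub>n - 1, 1]\<close> have the same value but different images).
  Entries are real so that intermediate lists with zero entries, and quotients built from a real
  sequence \<open>u\<close>, can be written down; integrality and positivity are expressed by \<open>regular_cf\<close>.
\<close>

definition regular_cf :: "real list \<Rightarrow> bool" where
  "regular_cf as \<longleftrightarrow>
     as \<noteq> [] \<and> hd as \<in> \<int> \<and> (\<forall>a\<in>set (tl as). a \<in> \<int> \<and> a > 0)"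

fun cf_val :: "real list \<Rightarrow> real" where
  "cf_val [] = 0"
| "cf_val [a] = a"
| "cf_val (a # b # as) = a + 1 / cf_val (b # as)"

text \<open>
  The concatenation rule \<open>[\<dots>, A, 0, B, \<dots>] = [\<dots>, A + B, \<dots>]\<close>, applied as long as possible.
  The entry \<open>a\<^sub>0\<close> has no left neighbour, so \<open>a\<^sub>0 = 0\<close> is never removed, as it should be.
\<close>

fun remove_zeros :: "real list \<Rightarrow> real list" where
  "remove_zeros (A # Z # B # as) =
     (if Z = 0 then remove_zeros ((A + B) # as) else A # remove_zeros (Z # B # as))"
| "remove_zeros as = as"

definition tilde :: "real list \<Rightarrow> real list" where
  "tilde a = butlast a @ [last a - 1, 1]"

text \<open>\<open>phi e z\<close> is \<open>\<phi>\<close> with superscript \<open>e \<in> {1, -1}\<close> and subscript \<open>z\<close>.\<close>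

definition phi :: "int \<Rightarrow> real \<Rightarrow> real list \<Rightarrow> real list" where
  "phi e z c =
     (let a\<^sub>0 = hd c; a = tl c in
      remove_zeros (a\<^sub>0 # (if e = 1 then a @ [z - 1] @ rev (tilde a)
                               else tilde a @ [z - 1] @ rev a)))"

text \<open>The infinite regular continued fraction \<open>[a\<^sub>0; a\<^sub>1, a\<^sub>2, \<dots>]\<close> has the value \<open>x\<close>.\<close>

definition cf_expansion :: "(nat \<Rightarrow> int) \<Rightarrow> real \<Rightarrow> bool" where
  "cf_expansion a x \<longleftrightarrow>
     (\<forall>k\<ge>1. a k > 0) \<and>
     (\<lambda>n. cf_val (map (\<lambda>k. real_of_int (a k)) [0..<Suc n])) \<longlonglongrightarrow> x"

text \<open>Entrywise limit: every partial quotient of \<open>\<Phi> n\<close> is eventually constant in \<open>n\<close>.\<close>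

definition cf_limit :: "(nat \<Rightarrow> real list) \<Rightarrow> (nat \<Rightarrow> int) \<Rightarrow> bool" where
  "cf_limit \<Phi> a \<longleftrightarrow>
     (\<forall>k. \<forall>\<^sub>F n in sequentially. k < length (\<Phi> n) \<and> \<Phi> n ! k = real_of_int (a k))"

definition series_term :: "(nat \<Rightarrow> real) \<Rightarrow> (nat \<Rightarrow> int) \<Rightarrow> nat \<Rightarrow> real" where
  "series_term u \<epsilon> j = real_of_int (\<epsilon> j) / ((\<Prod>k=1..<j. u k * (u k + 1)) * u j)"

end

theory Submission
  imports Defs "HOL-Analysis.Determinants"
begin

text \<open>Write a continued fraction as a product of matrices \<open>(a, 1; 1, 0)\<close>; this product is unchanged
  by the removal of zeros, and reversal is transposition. If \<open>c\<close> has value \<open>p/q\<close> and \<open>n\<close> partial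
  quotients after \<open>a\<^sub>0\<close>, then the folding \<open>phi e z c\<close> has value \<open>p/q + e (-1)\<^sup>n / (z q\<^sup>2)\<close> and
  denominator \<open>z q\<^sup>2\<close>. The recurrences are exactly such that the denominators
  \<open>Q\<^sub>n = u\<^sub>1 (u\<^sub>1 + 1) \<cdots> u\<^sub>n\<^sub>-\<^sub>1 (u\<^sub>n\<^sub>-\<^sub>1 + 1) u\<^sub>n\<close> of the partial sums satisfy
  \<open>Q\<^sub>n\<^sub>+\<^sub>1 = z\<^sub>n\<^sub>+\<^sub>1 Q\<^sub>n\<^sup>2\<close>. Each folding keeps all but the last two entries, so the lists stabilise,
  and truncating after \<open>a\<^sub>k\<close> changes the value by at most \<open>1/k\<close>.\<close>

section \<open>Matrices of continued fractions\<close>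

definition pq_mat :: "real \<Rightarrow> real^2^2" where
  "pq_mat a = vector [vector [a, 1], vector [1, 0]]"

text \<open>The first column holds numerator and denominator of the whole fraction, the second those
  of the preceding convergent.\<close>

fun cf_mat :: "real list \<Rightarrow> real^2^2" where
  "cf_mat [] = mat 1"
| "cf_mat (a # as) = pq_mat a ** cf_mat as"

lemma pq_mat_nth [simp]:
  "pq_mat a $ 1 $ 1 = a" "pq_mat a $ 1 $ 2 = 1" "pq_mat a $ 2 $ 1 = 1" "pq_mat a $ 2 $ 2 = 0"
  by (simp_all add: pq_mat_def)

lemma matrix_mult_2: "(A ** B) $ i $ j = A$i$1 * B$1$j + A$i$2 * B$2$j" for A B :: "real^2^2"
  by (simp add: matrix_matrix_mult_def sum_2)

lemma matrix_eq_2: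
  "A = B \<longleftrightarrow> A$1$1 = B$1$1 \<and> A$1$2 = B$1$2 \<and> A$2$1 = B$2$1 \<and> A$2$2 = B$2$2" for A B :: "real^2^2"
  by (auto simp: vec_eq_iff forall_2)

lemma cf_mat_append: "cf_mat (xs @ ys) = cf_mat xs ** cf_mat ys"
  by (induction xs) (simp_all add: matrix_mul_assoc)

lemma cf_mat_rev: "cf_mat (rev xs) = transpose (cf_mat xs)"
proof (induction xs)
  case (Cons a xs)
  have "transpose (pq_mat a) = pq_mat a"
    by (simp add: matrix_eq_2 transpose_def)
  then show ?case
    using Cons by (simp add: cf_mat_append matrix_transpose_mul)
qed simp

lemma det_cf_mat: "det (cf_mat xs) = (-1) ^ length xs"
proof (induction xs)
  case (Cons a xs)
  have "det (pq_mat a) = -1" by (simp add: det_2)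
  then show ?case using Cons by (simp add: det_mul)
qed simp

section \<open>Removal of zero partial quotients\<close>

lemma cf_mat_remove_zeros: "cf_mat (remove_zeros xs) = cf_mat xs"
proof (induction xs rule: remove_zeros.induct)
  case (1 A Z B as)
  have "pq_mat (A + B) = pq_mat A ** (pq_mat 0 ** pq_mat B)"
    by (simp add: matrix_eq_2 matrix_mult_2)
  then show ?case
    using 1 by (auto simp: matrix_mul_assoc)
qed simp_all

lemma even_length_remove_zeros: "even (length (remove_zeros xs)) = even (length xs)"
  by (induction xs rule: remove_zeros.induct) auto

text \<open>Each removal costs two entries and uses up one zero. The merged entry
  \<open>A + B\<close> becomes the head, so it never counts as a new zero of the tail.\<close>

lemma length_remove_zeros: "length xs \<le> length (remove_zeros xs) + 2 * count_list (tl xs) 0"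
  by (induction xs rule: remove_zeros.induct) (auto split: if_splits)

lemma remove_zeros_Ints: "set xs \<subseteq> \<int> \<Longrightarrow> set (remove_zeros xs) \<subseteq> \<int>"
  by (induction xs rule: remove_zeros.induct) auto

lemma remove_zeros_eq_Nil [simp]: "remove_zeros xs = [] \<longleftrightarrow> xs = []"
  by (induction xs rule: remove_zeros.induct) auto

text \<open>Merging only adds nonnegative entries to the head. Hence an entry that is positive when
  the recursion reaches it stays positive.\<close>

lemma hd_remove_zeros_ge:
  "xs \<noteq> [] \<Longrightarrow> \<forall>x\<in>set (tl xs). x \<ge> 0 \<Longrightarrow> hd (remove_zeros xs) \<ge> hd xs"
  by (induction xs rule: remove_zeros.induct) force+

text \<open>The condition on the last entry is there because a zero without a right neighbour would
  survive.\<close>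

lemma remove_zeros_pos:
  assumes "\<forall>x\<in>set (tl xs). x \<ge> 0" "tl xs \<noteq> [] \<longrightarrow> last xs > 0"
  shows "\<forall>x\<in>set (tl (remove_zeros xs)). x > 0"
  using assms
proof (induction xs rule: remove_zeros.induct)
  case (1 A Z B as)
  show ?case
  proof (cases "Z = 0")
    case True
    have "\<forall>x\<in>set (tl (remove_zeros ((A + B) # as))). x > 0"
      by (rule 1(1)[OF True]) (use 1(3,4) in auto)
    then show ?thesis using True by simp
  next
    case False
    let ?r = "remove_zeros (Z # B # as)"
    have "\<forall>x\<in>set (tl ?r). x > 0" by (rule 1(2)[OF False]) (use 1(3,4) in auto)
    moreover have "hd ?r \<ge> hd (Z # B # as)"
      by (rule hd_remove_zeros_ge) (use 1(3) in auto)
    then have "hd ?r > 0"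
      using 1(3) False by simp
    ultimately have "\<forall>x\<in>set ?r. x > 0"
      by (cases ?r) auto
    then show ?thesis using False by simp
  qed
qed auto

text \<open>The rule works from left to right, and a zero after \<open>y\<close> can change
  \<open>y\<close> but nothing before it. This shows that foldings keep a prefix.\<close>

lemma remove_zeros_append:
  "\<forall>x\<in>set (tl (xs @ [y])). x \<noteq> 0 \<Longrightarrow> remove_zeros (xs @ y # ys) = xs @ remove_zeros (y # ys)"
proof (induction xs)
  case (Cons x xs)
  have "\<forall>x\<in>set (tl (xs @ [y])). x \<noteq> 0"
    using Cons.prems by (cases xs) auto
  then have IH: "remove_zeros (xs @ y # ys) = xs @ remove_zeros (y # ys)"
    by (rule Cons.IH)
  obtain A t where t: "xs @ y # ys = A # t" "A \<noteq> 0"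
    using Cons.prems by (cases xs) auto
  have "remove_zeros (x # A # t) = x # remove_zeros (A # t)"
    using t(2) by (cases t) auto
  then show ?case using IH t by simp
qed simp

section \<open>Values, denominators and truncation\<close>

lemma cf_mat_ge:
  assumes "\<forall>x\<in>set xs. x \<ge> 1"
  shows "cf_mat xs $1$1 \<ge> cf_mat xs $2$1 \<and> cf_mat xs $1$1 \<ge> 1 \<and> cf_mat xs $1$1 \<ge> length xs
    \<and> cf_mat xs $1$2 \<ge> 0 \<and> cf_mat xs $2$2 \<ge> 0 \<and> cf_mat xs $2$1 \<ge> 0
    \<and> (xs \<noteq> [] \<longrightarrow> cf_mat xs $2$1 \<ge> 1)"
  using assms
proof (induction xs)
  case Nil
  then show ?case by (simp add: mat_def)
next
  case (Cons a xs)
  then have a: "a \<ge> 1" and IH: "cf_mat xs $1$1 \<ge> cf_mat xs $2$1" "cf_mat xs $1$1 \<ge> 1"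
      "cf_mat xs $1$1 \<ge> length xs" "cf_mat xs $1$2 \<ge> 0" "cf_mat xs $2$2 \<ge> 0"
      "cf_mat xs $2$1 \<ge> 0" "xs \<noteq> [] \<longrightarrow> cf_mat xs $2$1 \<ge> 1"
    by simp_all
  have "a * cf_mat xs $1$1 \<ge> 1 * cf_mat xs $1$1" "a * cf_mat xs $1$2 \<ge> 0"
    using a IH by (intro mult_right_mono mult_nonneg_nonneg; linarith)+
  note cols = this
  have "cf_mat (a # xs) $1$1 = a * cf_mat xs $1$1 + cf_mat xs $2$1"
    "cf_mat (a # xs) $1$2 = a * cf_mat xs $1$2 + cf_mat xs $2$2"
    "cf_mat (a # xs) $2$1 = cf_mat xs $1$1" "cf_mat (a # xs) $2$2 = cf_mat xs $1$2"
    by (simp_all add: matrix_mult_2)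
  note cols = cols this
  have "cf_mat (a # xs) $1$1 \<ge> length (a # xs)"
  \<comment> \<open>For nonempty \<open>xs\<close> the summand \<open>cf_mat xs $2$1\<close> is at
    least 1 and supplies the growth; for empty \<open>xs\<close> it is 0.\<close>
  proof (cases "xs = []")
    case True
    then show ?thesis using a by (simp add: matrix_mult_2 mat_def)
  next
    case False
    moreover have "real (length (a # xs)) = real (length xs) + 1" by simp
    ultimately show ?thesis using IH cols by linarith
  qed
  then show ?case
    using IH cols by linarith
qed

abbreviation cf_den :: "real list \<Rightarrow> real" where
  "cf_den xs \<equiv> cf_mat xs $2$1"

lemma regular_cf_ge_1: "regular_cf c \<Longrightarrow> x \<in> set (tl c) \<Longrightarrow> x \<ge> 1"
  unfolding regular_cf_def by (metis Ints_cases of_int_0_less_iff of_int_1_le_iff zless_imp_add1_zle add_0)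

text \<open>The denominator does not involve \<open>a0\<close>: it is the top left entry of the
  matrix of the tail. Linear growth suffices for the convergence of truncations.\<close>

lemma cf_den_ge:
  assumes "c \<noteq> []" "\<forall>x\<in>set (tl c). x \<ge> 1"
  shows "cf_den c \<ge> 1" "cf_den c \<ge> real (length c) - 1"
  using assms cf_mat_ge[of "tl c"] by (cases c; simp add: matrix_mult_2)+

lemma cf_val_eq:
  assumes "c \<noteq> []" "\<forall>x\<in>set (tl c). x \<ge> 1"
  shows "cf_val c = cf_mat c $1$1 / cf_den c"
  using assms
proof (induction c rule: cf_val.induct)
  case (3 a b as)
  let ?M = "cf_mat (b # as)"
  have "?M $1$1 \<ge> 1" using cf_mat_ge[of "b # as"] 3(3) by (simp del: cf_mat.simps)
  moreover have "cf_val (b # as) = ?M $1$1 / ?M $2$1" using 3 by simp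
  ultimately show ?case
    by (simp add: cf_mat.simps(2)[of a] matrix_mult_2[of "pq_mat a"] field_simps del: cf_mat.simps)
qed (simp_all add: matrix_mult_2 mat_def)

text \<open>If \<open>ys\<close> has value \<open>s / r\<close>, the longer fraction is
  \<open>(p * s + p' * r) / (q * s + q' * r)\<close>. Since the determinant is 1 or -1, it differs
  from \<open>p / q\<close> by \<open>r / (q * (q * s + q' * r))\<close>, and
  \<open>q * s + q' * r \<ge> r\<close>.\<close>

lemma cf_val_prefix:
  assumes "xs \<noteq> []" "\<forall>x\<in>set (tl (xs @ ys)). x \<ge> 1"
  shows "\<bar>cf_val (xs @ ys) - cf_val xs\<bar> \<le> 1 / cf_den xs"
proof (cases "ys = []")
  case True
  then show ?thesis using cf_den_ge[of xs] assms by simp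
next
  case False
  define p p' q q' where "p = cf_mat xs $1$1" "p' = cf_mat xs $1$2"
    "q = cf_mat xs $2$1" "q' = cf_mat xs $2$2"
  define s r where "s = cf_mat ys $1$1" "r = cf_mat ys $2$1"
  note defs = p_p'_q_q'_def s_r_def
  have tl: "\<forall>x\<in>set (tl xs). x \<ge> 1" "\<forall>x\<in>set ys. x \<ge> 1" using assms by auto
  have q: "q \<ge> 1" "q' \<ge> 0"
    using cf_den_ge[of xs] cf_mat_ge[of "tl xs"] assms(1) tl
    by (cases xs; simp add: defs matrix_mult_2)+
  have s: "s \<ge> r" "r \<ge> 1" using cf_mat_ge[of ys] tl False by (auto simp: defs)
  have "\<bar>p * q' - p' * q\<bar> = 1"
    using det_cf_mat[of xs] unfolding det_2 defs by (simp add: power_abs)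
  moreover have "q * s \<ge> 1 * r" "q' * r \<ge> 0" using q s by (intro mult_mono mult_nonneg_nonneg; linarith)+
  then have D: "q * s + q' * r \<ge> r" by linarith
  have "cf_val (xs @ ys) = (p * s + p' * r) / (q * s + q' * r)"
    using assms by (subst cf_val_eq) (auto simp: cf_mat_append matrix_mult_2 defs)
  moreover have "cf_val xs = p / q"
    using assms tl by (subst cf_val_eq) (auto simp: defs)
  ultimately have "cf_val (xs @ ys) - cf_val xs = - (p * q' - p' * q) * r / (q * (q * s + q' * r))"
    using q s D by (simp add: diff_frac_eq algebra_simps)
  then have "\<bar>cf_val (xs @ ys) - cf_val xs\<bar> = r / (q * (q * s + q' * r))"
    using \<open>\<bar>p * q' - p' * q\<bar> = 1\<close> q s D by (simp add: abs_mult)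
  also have "\<dots> = 1 / q * (r / (q * s + q' * r))" by simp
  also have "\<dots> \<le> 1 / q * 1"
    using q s D by (intro mult_left_mono) (simp_all add: divide_le_eq)
  finally show ?thesis by (simp add: defs)
qed

section \<open>The folding map\<close>

text \<open>Splitting the last entry \<open>x\<close> into \<open>x - 1, 1\<close> keeps the value,
  hence the first column, and replaces the preceding convergent \<open>p' / q'\<close> by
  \<open>(p - p') / (q - q')\<close>.\<close>

lemma cf_mat_tilde:
  assumes "a \<noteq> []"
  shows "cf_mat (tilde a) $ i $ 1 = cf_mat a $ i $ 1"
    and "cf_mat (tilde a) $ i $ 2 = cf_mat a $ i $ 1 - cf_mat a $ i $ 2"
proof -
  obtain b x where a: "a = b @ [x]" using assms by (metis rev_exhaust)
  show "cf_mat (tilde a) $ i $ 1 = cf_mat a $ i $ 1"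
    "cf_mat (tilde a) $ i $ 2 = cf_mat a $ i $ 1 - cf_mat a $ i $ 2"
    by (simp_all add: a tilde_def cf_mat_append matrix_mult_2 mat_def algebra_simps)
qed

text \<open>Let \<open>cf_mat c = (p, p'; q, q')\<close> with \<open>c = a\<^sub>0 # a\<close>. The matrix of \<open>rev a\<close> is the transpose of
  that of \<open>a\<close>, so its first column is \<open>(q, q')\<close>, and \<open>(q, q - q')\<close> for \<open>rev (tilde a)\<close>. In the
  latter case the new first column is \<open>(z p q - (p q' - p' q), z q\<^sup>2)\<close>.\<close>

lemma cf_mat_phi:
  assumes "length c \<ge> 2" "e \<in> {1, -1}"
  shows "cf_den (phi e z c) = z * (cf_den c)^2"
    and "cf_mat (phi e z c) $1$1 = z * cf_mat c $1$1 * cf_den c + e * (-1) ^ (length c - 1)"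
proof -
  obtain a0 a where c: "c = a0 # a" and a: "a \<noteq> []"
    using assms(1) by (cases c rule: cf_val.cases) auto
  have d: "cf_mat a $1$1 * cf_mat a $2$2 = (-1) ^ length a + cf_mat a $1$2 * cf_den a"
    using det_cf_mat[of a] by (simp add: det_2)
  show "cf_den (phi e z c) = z * (cf_den c)^2"
    using assms(2) a by (auto simp: c phi_def Let_def cf_mat_remove_zeros cf_mat_append cf_mat_rev
      transpose_def matrix_mult_2 cf_mat_tilde power2_eq_square algebra_simps)
  show "cf_mat (phi e z c) $1$1 = z * cf_mat c $1$1 * cf_den c + e * (-1) ^ (length c - 1)"
    using assms(2) a by (auto simp: c phi_def Let_def cf_mat_remove_zeros cf_mat_append cf_mat_rev
      transpose_def matrix_mult_2 cf_mat_tilde power2_eq_square d algebra_simps)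
qed

text \<open>The last hypothesis concerns a single partial quotient \<open>x\<close>: for
  \<open>e = 1\<close> the unreduced list ends in \<open>x - 1\<close>, which must not be zero. In
  longer lists the final entry is the first partial quotient of \<open>c\<close>.\<close>

lemma regular_cf_phi:
  assumes "regular_cf c" "length c \<ge> 2" "z \<in> \<int>" "z > 1" "length c = 2 \<longrightarrow> c ! 1 > 1"
  shows "regular_cf (phi e z c)"
proof -
  obtain a0 a where c: "c = a0 # a" and a: "a \<noteq> []"
    using assms(2) by (cases c rule: cf_val.cases) auto
  obtain b x where ab: "a = b @ [x]" using a by (metis rev_exhaust)
  have ge: "\<forall>y\<in>set a. y \<ge> 1" "a0 \<in> \<int>" "set a \<subseteq> \<int>"
    using regular_cf_ge_1[OF assms(1)] assms(1) by (auto simp: c regular_cf_def)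
  define w where "w = a0 # (if e = 1 then a @ [z - 1] @ rev (tilde a) else tilde a @ [z - 1] @ rev a)"
  have w: "phi e z c = remove_zeros w" by (simp add: phi_def w_def c)
  have "set w \<subseteq> \<int>" using ge assms(3) by (auto simp: w_def tilde_def ab)
  then have Ints: "set (remove_zeros w) \<subseteq> \<int>" by (rule remove_zeros_Ints)
  have "\<forall>y\<in>set (tl w). y \<ge> 0"
    using ge assms(4) by (auto simp: w_def tilde_def ab intro: order_trans[OF zero_le_one])
  moreover have "last w > 0"
    using assms(5) ge by (cases b) (auto simp: w_def tilde_def ab c)
  ultimately have "\<forall>y\<in>set (tl (remove_zeros w)). y > 0" by (intro remove_zeros_pos) auto
  moreover have "remove_zeros w \<noteq> []" by (simp add: w_def)
  ultimately show ?thesis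
    using Ints unfolding regular_cf_def w by (cases "remove_zeros w") auto
qed

text \<open>The unreduced list has length \<open>2 * length c + 1\<close>, and its only possible
  zero after \<open>a0\<close> is \<open>x - 1\<close>, so at most two entries are lost. The parity
  is unaffected because entries disappear in pairs.\<close>

lemma length_phi:
  assumes "regular_cf c" "length c \<ge> 2" "z > 1"
  shows "length (phi e z c) > length c" "odd (length (phi e z c))"
proof -
  obtain a0 a where c: "c = a0 # a" and a: "a \<noteq> []"
    using assms(2) by (cases c rule: cf_val.cases) auto
  obtain b x where ab: "a = b @ [x]" using a by (metis rev_exhaust)
  have nz: "0 \<notin> set a" using assms(1) by (auto simp: c regular_cf_def)
  define w where "w = a0 # (if e = 1 then a @ [z - 1] @ rev (tilde a) else tilde a @ [z - 1] @ rev a)"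
  have w: "phi e z c = remove_zeros w" by (simp add: phi_def w_def c)
  have "count_list b 0 = 0" "count_list (rev b) 0 = 0" "x \<noteq> 0"
    using nz by (auto simp: ab count_list_0_iff)
  then have "count_list (tl w) 0 \<le> 1"
    using assms(3) by (simp add: w_def tilde_def ab)
  moreover have len: "length w = 2 * length c + 1" by (simp add: w_def c tilde_def ab)
  ultimately show "length (phi e z c) > length c"
    using length_remove_zeros[of w] assms(2) unfolding w by linarith
  show "odd (length (phi e z c))"
    unfolding w even_length_remove_zeros by (simp add: len)
qed

text \<open>The last two entries may change: \<open>[\<dots>, A, 1]\<close> becomes \<open>[\<dots>, A, 0, 1, \<dots>] = [\<dots>, A + 1, \<dots>]\<close>.\<close>

lemma phi_nth:
  assumes "regular_cf c" "k < length c - 2"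
  shows "phi e z c ! k = c ! k"
proof -
  obtain b x y where c: "c = b @ [x, y]" and b: "b \<noteq> []"
  proof -
    obtain b' y where "c = b' @ [y]" using assms by (cases c rule: rev_cases) auto
    moreover from this obtain b x where "b' = b @ [x]" using assms by (cases b' rule: rev_cases) auto
    ultimately show ?thesis using that[of b x y] assms(2) by force
  qed
  obtain a0 d where d: "b = a0 # d" using b by (cases b) auto
  have nz: "\<forall>x\<in>set (tl (b @ [x])). x \<noteq> 0" using assms(1) by (auto simp: c d regular_cf_def)
  have "\<exists>ys. phi e z c = remove_zeros (b @ x # ys)"
    by (auto simp: phi_def Let_def c d tilde_def butlast_append)
  then obtain ys where "phi e z c = b @ remove_zeros (x # ys)"
    using remove_zeros_append[OF nz] by auto
  then show ?thesis using assms(2) by (simp add: c nth_append)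
qed

section \<open>Denominators of the partial sums\<close>

text \<open>The key is the closed form \<open>u (n + 1) = Q n * w n * \<rho> n\<close>, where
  \<open>w n\<close> is \<open>u n * (u n + 1)\<close> in case (A) and 1 in case (B). It also yields
  integrality of \<open>u\<close>, which the division in case (A) leaves open.\<close>

lemma denominator_recurrence:
  fixes u :: "nat \<Rightarrow> real" and \<rho> \<alpha> :: "nat \<Rightarrow> nat" and m :: nat and z :: "nat \<Rightarrow> real"
  defines "Q \<equiv> \<lambda>n. (\<Prod>k=1..<n. u k * (u k + 1)) * u n"
  assumes alpha: "\<And>n. n \<ge> 1 \<Longrightarrow> \<alpha> n > 0"
    and u1: "u 1 \<in> \<int>" "u 1 > 1"
    and m: "m > 0"
    and rho: "\<And>n. n \<ge> 1 \<Longrightarrow> \<rho> n = m * (\<Prod>k=1..<n. \<alpha> k)"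
    and cases_A_B:
      "((\<forall>n\<ge>1. u (n + 2) * u n = real (\<alpha> n) * u (n + 1) ^ 3 * (u (n + 1) + 1)) \<and>
        u 2 = real m * u 1 ^ 2 * (u 1 + 1) \<and>
        (\<forall>n\<ge>1. z (n + 1) = u n * (u n + 1) ^ 2 * real (\<rho> n)))
       \<or>
       ((\<forall>n\<ge>1. u (n + 2) = real (\<alpha> n) * u (n + 1) ^ 2 * (u n + 1)) \<and>
        u 2 = real m * u 1 \<and>
        (\<forall>n\<ge>1. z (n + 1) = (u n + 1) * real (\<rho> n)))"
    and n: "n \<ge> 1"
  shows "z (n + 1) \<in> \<int> \<and> z (n + 1) \<ge> 2 \<and> Q (n + 1) = z (n + 1) * (Q n)^2"
proof -
  have rho1: "\<rho> 1 = m" using rho[of 1] by simp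
  have rhoS: "\<rho> (n + 1) = \<rho> n * \<alpha> n" if "n \<ge> 1" for n
    using that rho by simp
  have rho_pos: "\<rho> n \<ge> 1" if "n \<ge> 1" for n
    using that by (induction n rule: dec_induct) (use m rho1 rhoS alpha in \<open>auto simp: Suc_le_eq\<close>)
  have QS: "Q (n + 1) = Q n * (u n + 1) * u (n + 1)" if "n \<ge> 1" for n
    using that by (simp add: Q_def algebra_simps)
  have Q1: "Q 1 = u 1" by (simp add: Q_def)
  \<comment> \<open>The factor \<open>w\<close> brings both cases into one form, so that a single
    induction serves them.\<close>
  obtain w where w1: "\<And>n. u n \<in> \<int> \<Longrightarrow> u n \<ge> 1 \<Longrightarrow> w n \<in> \<int> \<and> w n \<ge> 1"
    and u2: "u 2 = real m * u 1 * w 1"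
    and z: "\<And>n. n \<ge> 1 \<Longrightarrow> z (n + 1) = w n * (u n + 1) * real (\<rho> n)"
    and uS: "\<And>n. n \<ge> 1 \<Longrightarrow> u (n + 2) * w n = real (\<alpha> n) * u (n + 1) ^ 2 * (u n + 1) * w (n + 1)"
    using cases_A_B
  proof (elim disjE conjE)
    assume A: "\<forall>n\<ge>1. u (n + 2) * u n = real (\<alpha> n) * u (n + 1) ^ 3 * (u (n + 1) + 1)"
      and A': "u 2 = real m * u 1 ^ 2 * (u 1 + 1)"
        "\<forall>n\<ge>1. z (n + 1) = u n * (u n + 1) ^ 2 * real (\<rho> n)"
    show thesis
    proof (rule that[of "\<lambda>n. u n * (u n + 1)"])
      show "u n * (u n + 1) \<in> \<int> \<and> u n * (u n + 1) \<ge> 1" if "u n \<in> \<int>" "u n \<ge> 1" for n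
        using that mult_mono[of 1 "u n" 1 "u n + 1"] by auto
      show "u (n + 2) * (u n * (u n + 1)) =
          real (\<alpha> n) * u (n + 1) ^ 2 * (u n + 1) * (u (n + 1) * (u (n + 1) + 1))" if "n \<ge> 1" for n
      proof -
        have "u (n + 2) * (u n * (u n + 1)) = (u (n + 2) * u n) * (u n + 1)" by simp
        also have "\<dots> = real (\<alpha> n) * u (n + 1) ^ 3 * (u (n + 1) + 1) * (u n + 1)"
          using A that by simp
        finally show ?thesis by (simp add: power3_eq_cube power2_eq_square)
      qed
    qed (use A' in \<open>simp_all add: power2_eq_square\<close>)
  qed (rule that[of "\<lambda>_. 1"], auto)
  have main: "u n \<in> \<int> \<and> u n \<ge> 1 \<and> Q n \<in> \<int> \<and> Q n \<ge> 1 \<and> u (n + 1) = Q n * w n * \<rho> n" if "n \<ge> 1" for n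
    using that
  proof (induction n rule: dec_induct)
    case base
    then show ?case using u1 u2 by (simp add: Q1[simplified] rho1[simplified] numeral_2_eq_2)
  next
    case (step n)
    then have un: "u n \<in> \<int>" "u n \<ge> 1" and Qn: "Q n \<in> \<int>" "Q n \<ge> 1"
      and u': "u (n + 1) = Q n * w n * \<rho> n" by auto
    note w = w1[OF un]
    have "u (n + 1) \<in> \<int>" unfolding u' using Qn w by auto
    moreover have "Q n * w n * \<rho> n \<ge> 1 * 1 * 1"
      using Qn w rho_pos[of n] step by (intro mult_mono) auto
    then have "u (n + 1) \<ge> 1" unfolding u' by simp
    moreover from calculation have "Q (n + 1) \<in> \<int>" using Qn un QS[of n] step by auto
    moreover have "Q n * (u n + 1) * u (n + 1) \<ge> 1 * 1 * 1"
      using Qn un \<open>u (n + 1) \<ge> 1\<close> by (intro mult_mono) auto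
    then have "Q (n + 1) \<ge> 1" using QS[of n] step by simp
    \<comment> \<open>Of the two factors \<open>u (n + 1)\<close> in \<open>uS\<close>, one is
      expanded by the induction hypothesis and the other completes \<open>Q (n + 1)\<close>; then
      \<open>w n\<close> cancels.\<close>
    moreover have "u (n + 2) * w n = (Q (n + 1) * w (n + 1) * \<rho> (n + 1)) * w n"
      using uS[of n] QS[of n] rhoS[of n] step u' by (simp add: power2_eq_square mult_ac)
    then have "u (n + 2) = Q (n + 1) * w (n + 1) * \<rho> (n + 1)"
      using w by simp
    ultimately show ?case by simp
  qed
  have "w n * (u n + 1) * \<rho> n \<ge> 1 * 2 * 1"
    using main[OF n] w1[of n] rho_pos[OF n] by (intro mult_mono) auto
  moreover have "w n * (u n + 1) * \<rho> n \<in> \<int>"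
    using main[OF n] w1[of n] by auto
  moreover have "Q (n + 1) = z (n + 1) * (Q n)^2"
    using main[OF n] QS[OF n] z[OF n] by (simp add: power2_eq_square)
  ultimately show ?thesis using z[OF n] by simp
qed

section \<open>Limit of the continued fractions\<close>

lemma cf_expansion_limit:
  assumes reg: "\<And>n. n \<ge> 1 \<Longrightarrow> regular_cf (\<Phi> n)"
    and len: "\<And>n. n \<ge> 1 \<Longrightarrow> length (\<Phi> n) \<ge> n + 1"
    and nth: "\<And>n k. n \<ge> 1 \<Longrightarrow> k < length (\<Phi> n) - 2 \<Longrightarrow> \<Phi> (n + 1) ! k = \<Phi> n ! k"
    and lim: "(\<lambda>n. cf_val (\<Phi> n)) \<longlonglongrightarrow> x"
  shows "\<exists>a. cf_limit \<Phi> a \<and> cf_expansion a x"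
proof -
  \<comment> \<open>From \<open>n = k + 2\<close> on the length is at least \<open>k + 3\<close>, so
    position \<open>k\<close> lies before the two entries that may still change.\<close>
  have stable: "\<Phi> n ! k = \<Phi> (k + 2) ! k" if "n \<ge> k + 2" for n k
    using that
  proof (induction n rule: dec_induct)
    case (step n)
    then show ?case using nth[of n k] len[of n] by simp
  qed simp
  define a where "a k = \<lfloor>\<Phi> (k + 2) ! k\<rfloor>" for k
  have mem: "\<Phi> n ! k \<in> \<int> \<and> (k \<ge> 1 \<longrightarrow> \<Phi> n ! k > 0)" if "n \<ge> 1" "k < length (\<Phi> n)" for n k
    using reg[OF that(1)] that(2) by (cases "\<Phi> n"; cases k) (auto simp: regular_cf_def)
  have a: "real_of_int (a k) = \<Phi> n ! k" if "n \<ge> k + 2" for n k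
    using mem[of "k + 2" k] len[of "k + 2"] stable[OF that] by (simp add: a_def)
  have "cf_limit \<Phi> a"
    unfolding cf_limit_def
  proof
    fix k
    show "\<forall>\<^sub>F n in sequentially. k < length (\<Phi> n) \<and> \<Phi> n ! k = real_of_int (a k)"
      using eventually_ge_at_top[of "k + 2"]
    proof eventually_elim
      case (elim n)
      then show ?case using len[of n] a by simp
    qed
  qed
  moreover have "a k > 0" if "k \<ge> 1" for k
    using that mem[of "k + 2" k] len[of "k + 2"] a[of k "k + 2"] by simp
  moreover have "(\<lambda>k. cf_val (map (\<lambda>k. real_of_int (a k)) [0..<Suc k])) \<longlonglongrightarrow> x"
  proof (rule Lim_transform)
    show "(\<lambda>k. cf_val (\<Phi> (k + 2))) \<longlonglongrightarrow> x"
      by (rule LIMSEQ_ignore_initial_segment[OF lim])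
    have "\<bar>cf_val (map (\<lambda>k. real_of_int (a k)) [0..<Suc k]) - cf_val (\<Phi> (k + 2))\<bar> \<le> 1 / real k"
      if "k \<ge> 1" for k
    proof -
      \<comment> \<open>All entries up to position \<open>k\<close> are final here, so the truncated
        limit is a prefix of this list, with denominator at least \<open>k\<close>.\<close>
      let ?c = "\<Phi> (k + 2)" and ?xs = "take (Suc k) (\<Phi> (k + 2))"
      have xs: "map (\<lambda>k. real_of_int (a k)) [0..<Suc k] = ?xs"
        using len[of "k + 2"] a[of _ "k + 2"] by (intro nth_equalityI) (auto simp del: upt_Suc)
      have ge: "\<forall>y\<in>set (tl ?c). y \<ge> 1" and ne: "?xs \<noteq> []"
        using regular_cf_ge_1[OF reg[of "k + 2"]] len[of "k + 2"] by auto
      then have "\<bar>cf_val ?c - cf_val ?xs\<bar> \<le> 1 / cf_den ?xs"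
        using cf_val_prefix[of ?xs "drop (Suc k) ?c"] by simp
      also have "\<forall>y\<in>set (tl ?xs). y \<ge> 1"
        using ge by (auto simp: tl_take dest: in_set_takeD)
      then have "1 / cf_den ?xs \<le> 1 / real k"
        using cf_den_ge(2)[OF ne] len[of "k + 2"] that by (intro divide_left_mono) auto
      finally show ?thesis unfolding xs by (simp add: abs_minus_commute)
    qed
    then show "(\<lambda>k. cf_val (map (\<lambda>k. real_of_int (a k)) [0..<Suc k]) - cf_val (\<Phi> (k + 2))) \<longlonglongrightarrow> 0"
      by (intro tendsto_0_le[OF lim_1_over_n[where 'a = real], where K = 1] eventually_sequentiallyI[of 1]) simp
  qed
  ultimately show ?thesis unfolding cf_expansion_def by blast
qed


theorem theorem3p6:
  fixes \<alpha> :: "nat \<Rightarrow> nat" and u :: "nat \<Rightarrow> real" and m :: nat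
    and \<epsilon> :: "nat \<Rightarrow> int" and \<rho> :: "nat \<Rightarrow> nat" and z :: "nat \<Rightarrow> real"
    and \<Phi> :: "nat \<Rightarrow> real list" and S' :: real
  assumes alpha: "\<And>n. n \<ge> 1 \<Longrightarrow> \<alpha> n > 0"
    and u1: "u 1 \<in> \<int>" "u 1 > 1"
    and m: "m > 0"
    and eps: "\<And>j. j \<ge> 2 \<Longrightarrow> \<epsilon> j \<in> {1, -1}"
    and rho: "\<And>n. n \<ge> 1 \<Longrightarrow> \<rho> n = m * (\<Prod>k=1..<n. \<alpha> k)"
    and cases_A_B:
      "((\<forall>n\<ge>1. u (n + 2) * u n = real (\<alpha> n) * u (n + 1) ^ 3 * (u (n + 1) + 1)) \<and>
        u 2 = real m * u 1 ^ 2 * (u 1 + 1) \<and>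
        (\<forall>n\<ge>1. z (n + 1) = u n * (u n + 1) ^ 2 * real (\<rho> n)))
       \<or>
       ((\<forall>n\<ge>1. u (n + 2) = real (\<alpha> n) * u (n + 1) ^ 2 * (u n + 1)) \<and>
        u 2 = real m * u 1 \<and>
        (\<forall>n\<ge>1. z (n + 1) = (u n + 1) * real (\<rho> n)))"
    and Phi_1: "\<Phi> 1 = [0, u 1]"
    and Phi_2: "\<Phi> 2 = phi (- \<epsilon> 2) (z 2) (\<Phi> 1)"
    and Phi_Suc: "\<And>n. n \<ge> 2 \<Longrightarrow> \<Phi> (n + 1) = phi (\<epsilon> (n + 1)) (z (n + 1)) (\<Phi> n)"
    and S': "S' = 1 / u 1 + (\<Sum>j. series_term u \<epsilon> (j + 2))"
  shows "summable (\<lambda>j. series_term u \<epsilon> (j + 2))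
    \<and> (\<forall>n\<ge>1. regular_cf (\<Phi> n) \<and>
          1 / u 1 + (\<Sum>j=2..n. series_term u \<epsilon> j) = cf_val (\<Phi> n))
    \<and> (\<lambda>n. cf_val (\<Phi> n)) \<longlonglongrightarrow> S'
    \<and> (\<exists>a. cf_limit \<Phi> a \<and> cf_expansion a S')"
proof -
  define Q where "Q = (\<lambda>n. (\<Prod>k=1..<n. u k * (u k + 1)) * u n)"
  have Q1: "Q 1 = u 1" by (simp add: Q_def)
  have rec: "z (n + 1) \<in> \<int>" "z (n + 1) \<ge> 2" "Q (n + 1) = z (n + 1) * (Q n)^2" if "n \<ge> 1" for n
    using denominator_recurrence[OF alpha u1 m rho cases_A_B that] unfolding Q_def by auto
  \<comment> \<open>This crude bound, from \<open>z (n + 1) \<ge> 2\<close> and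
    \<open>Q n \<ge> 1\<close>, gives positivity of \<open>Q\<close> and a geometric majorant of the
    series.\<close>
  have Q_ge: "Q n \<ge> 2 ^ (n - 1)" if "n \<ge> 1" for n
    using that
  proof (induction n rule: dec_induct)
    case base
    then show ?case using u1 Q1 by simp
  next
    case (step n)
    have "(1::real) \<le> 2 ^ (n - 1)" by simp
    then have "Q n \<ge> 1" using step.IH by linarith
    then have "2 * (2 ^ (n - 1) * 1) \<le> z (n + 1) * (Q n * Q n)"
      using rec(2)[of n] step \<open>Q n \<ge> 1\<close> by (intro mult_mono) auto
    then show ?case
      using rec(3)[of n] step by (cases n) (auto simp: power2_eq_square)
  qed
  have term_eq: "series_term u \<epsilon> j = \<epsilon> j / Q j" for j
    by (simp add: series_term_def Q_def)
  have summable: "summable (\<lambda>j. series_term u \<epsilon> (j + 2))"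
  proof (rule summable_comparison_test')
    show "summable (\<lambda>j. (1 / 2 :: real) ^ j)" by (simp add: summable_geometric)
    fix j :: nat assume "j \<ge> 0"
    have "\<bar>real_of_int (\<epsilon> (j + 2))\<bar> = 1" using eps[of "j + 2"] by auto
    moreover have pos: "(0::real) < 2 ^ j" by simp
    moreover have "2 * 2 ^ j \<le> Q (j + 2)" using Q_ge[of "j + 2"] by simp
    then have "2 ^ j \<le> Q (j + 2)" using pos by linarith
    ultimately show "norm (series_term u \<epsilon> (j + 2)) \<le> (1 / 2) ^ j"
      by (simp add: term_eq power_one_over frac_le)
  qed
  text \<open>The sign of the first step is reversed because \<open>[u\<^sub>1]\<close> has odd length; afterwards
    the number of partial quotients after \<open>a\<^sub>0\<close> is even.\<close>
  define e where "e n = (if n = 1 then - \<epsilon> 2 else \<epsilon> (n + 1))" for n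
  have Phi_step: "\<Phi> (n + 1) = phi (e n) (z (n + 1)) (\<Phi> n)" if "n \<ge> 1" for n
    using that Phi_2 Phi_Suc[of n] by (cases "n = 1") (auto simp: e_def numeral_2_eq_2)
  have e: "e n \<in> {1, -1}" if "n \<ge> 1" for n
    using that eps[of 2] eps[of "n + 1"] by (auto simp: e_def)
  \<comment> \<open>The parity fixes the sign of the next term and the denominator its size, so both
    belong to the induction hypothesis.\<close>
  have Phi: "regular_cf (\<Phi> n) \<and> length (\<Phi> n) \<ge> n + 1 \<and> (n > 1 \<longrightarrow> odd (length (\<Phi> n)))
      \<and> cf_den (\<Phi> n) = Q n \<and> 1 / u 1 + (\<Sum>j=2..n. series_term u \<epsilon> j) = cf_val (\<Phi> n)"
    if "n \<ge> 1" for n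
    using that
  proof (induction n rule: dec_induct)
    case base
    then show ?case
      using u1 Phi_1 Q1 by (auto simp: regular_cf_def matrix_mult_2 mat_def)
  next
    case (step n)
    let ?c = "\<Phi> n" and ?c' = "\<Phi> (n + 1)"
    have IH: "regular_cf ?c" "length ?c \<ge> n + 1" "n > 1 \<longrightarrow> odd (length ?c)" "cf_den ?c = Q n"
      "1 / u 1 + (\<Sum>j=2..n. series_term u \<epsilon> j) = cf_val ?c"
      using step.IH by auto
    have len2: "length ?c \<ge> 2" using IH(2) step by simp
    have z: "z (n + 1) > 1" using rec(2)[of n] step by simp
    have c': "?c' = phi (e n) (z (n + 1)) ?c" using Phi_step step by simp
    \<comment> \<open>Only \<open>\<Phi> 1\<close> has length 2; this is where
      \<open>u 1 > 1\<close> rather than \<open>u 1 \<ge> 1\<close> enters.\<close>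
    have first: "length ?c = 2 \<longrightarrow> ?c ! 1 > 1"
      using IH(2) step Phi_1 u1 by (cases "n = 1") auto
    have reg: "regular_cf ?c'"
      unfolding c' using regular_cf_phi[OF IH(1) len2 rec(1) z first] step by simp
    have len: "length ?c' > length ?c" "odd (length ?c')"
      unfolding c' using length_phi[OF IH(1) len2 z] by auto
    note mat = cf_mat_phi[OF len2 e, of n "z (n + 1)", folded c']
    have den: "cf_den ?c' = Q (n + 1)"
      using mat(1) rec(3)[of n] IH(4) step by simp
    have sign: "e n * (-1) ^ (length ?c - 1) = \<epsilon> (n + 1)"
    proof (cases "n = 1")
      case True
      then show ?thesis using Phi_1 by (simp add: e_def numeral_2_eq_2)
    next
      case False
      then have "even (length ?c - 1)" using IH(3) step by simp
      then show ?thesis using False by (simp add: e_def)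
    qed
    have "(0::real) < 2 ^ (n - 1)" by simp
    then have Q_pos: "Q n > 0" using Q_ge[of n] step by linarith
    have val: "cf_val c = cf_mat c $1$1 / cf_den c" if "regular_cf c" for c
      using that regular_cf_ge_1[OF that] by (intro cf_val_eq) (auto simp: regular_cf_def)
    have "cf_val ?c' = (z (n + 1) * cf_mat ?c $1$1 * Q n + \<epsilon> (n + 1)) / Q (n + 1)"
      using val[OF reg] mat(2) den IH(4) step sign by (simp flip: of_int_mult of_int_power sign)
    also have "\<dots> = cf_mat ?c $1$1 / Q n + \<epsilon> (n + 1) / Q (n + 1)"
      using rec(2,3)[of n] Q_pos step by (simp add: add_divide_distrib power2_eq_square)
    finally have "cf_val ?c' = cf_val ?c + series_term u \<epsilon> (n + 1)"
      using val[OF IH(1)] IH(4) by (simp add: term_eq)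
    then have "1 / u 1 + (\<Sum>j=2..Suc n. series_term u \<epsilon> j) = cf_val ?c'"
      using IH(5) step by simp
    then show ?case using reg len den IH(2) by simp
  qed
  have "(\<lambda>n. \<Sum>j<n. series_term u \<epsilon> (j + 2)) \<longlonglongrightarrow> (\<Sum>j. series_term u \<epsilon> (j + 2))"
    using summable by (rule summable_LIMSEQ)
  moreover have "(\<Sum>j<n. series_term u \<epsilon> (j + 2)) = (\<Sum>j=2..n + 1. series_term u \<epsilon> j)" for n
    by (induction n) auto
  ultimately have "(\<lambda>n. 1 / u 1 + (\<Sum>j=2..n + 1. series_term u \<epsilon> j)) \<longlonglongrightarrow> S'"
    unfolding S' by (intro tendsto_add) auto
  moreover have "1 / u 1 + (\<Sum>j=2..n + 1. series_term u \<epsilon> j) = cf_val (\<Phi> (n + 1))" for n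
    using Phi[of "n + 1"] by simp
  ultimately have "(\<lambda>n. cf_val (\<Phi> (n + 1))) \<longlonglongrightarrow> S'"
    by (simp only:)
  then have lim: "(\<lambda>n. cf_val (\<Phi> n)) \<longlonglongrightarrow> S'"
    by (rule LIMSEQ_offset)
  moreover have "\<exists>a. cf_limit \<Phi> a \<and> cf_expansion a S'"
  proof (rule cf_expansion_limit[OF _ _ _ lim])
    fix n k :: nat assume n: "n \<ge> 1" and k: "k < length (\<Phi> n) - 2"
    show "\<Phi> (n + 1) ! k = \<Phi> n ! k"
      unfolding Phi_step[OF n] using Phi[OF n] k by (intro phi_nth) auto
  qed (use Phi in auto)
  ultimately show ?thesis using summable Phi by auto
qed

end
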